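(* Let $I$ be a past interval, $E$ a Banach space, $H\subset\mathrm{Map}(I,E)$ a history space, $F\colon\mathbb{R}\times H\supset\mathrm{dom}(F)\to E$ a map, and $(\sigma_0,\psi_0)\in\mathrm{dom}(F)$. Suppose that $H$ is closed under prolongations. If $F$ is uniformly locally Lipschitzian about prolongations at $(\sigma_0,\psi_0)$, and if $F$ is locally bounded at $(\sigma_0,\psi_0)$ (i.e. bounded on some neighborhood of $(\sigma_0,\psi_0)$ in $\mathrm{dom}(F)$), then $F$ is uniformly locally Lipschitzian about $C^1$-prolongations at $(\sigma_0,\psi_0)$.
   Context: Basic notation. $\mathbb{R}_+=[0,\infty)$, $\mathbb{R}_-=(-\infty,0]$. A past interval is an interval $I\subset\mathbb{R}_-$ with $0\in I$. $\mathrm{Map}(I,E)$ is the linear space of all maps $I\to E$. For an interval $J$, $J+I=\{t+\theta:t\in J,\theta\in I\}$. If $\gamma\colon J+I\to E$ and $t\in J$, then $I_t\gamma\in\mathrm{Map}(I,E)$ is $I_t\gamma(\theta)=\gamma(t+\theta)$. A history space is a linear subspace $H\subset\mathrm{Map}(I,E)$ with a topology for which the linear operations are continuous. Prolongations. For $(\sigma,\psi)\in\mathbb{R}\times\mathrm{Map}(I,E)$, a prolongation (resp. $C^1$-prolongation) of $(\sigma,\psi)$ is a map $\gamma\colon J+I\to E$, where $J$ is an interval with left end point $\sigma\in J$ ($J=\{\sigma\}$ allowed, counting as $C^1$), with $I_\sigma\gamma=\psi$ and $\gamma|_J$ continuous (resp. of class $C^1$). A prolongation of $\psi$ is one of $(0,\psi)$.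 $H$ is closed under prolongations if $I_t\gamma\in H$ for all $t\ge0$, for every $\psi\in H$ and every prolongation $\gamma\colon\mathbb{R}_++I\to E$ of $\psi$. For $v\in E$, $\psi^{\wedge v}\colon\mathbb{R}_++I\to E$ is $\psi^{\wedge v}(t)=\psi(t)$ for $t\in I$ and $\psi^{\wedge v}(t)=\psi(0)+tv$ for $t\ge0$. $\|g\|_{C^1[0,T]}=\sup_{[0,T]}\|g\|_E+\sup_{[0,T]}\|g'\|_E$. $\varGamma_{\sigma,\psi}(T,\delta)$ ($T\ge0$, $0\le\delta\le\infty$) is the set of prolongations $\gamma\colon[\sigma,\sigma+T]+I\to E$ of $(\sigma,\psi)$ with $\sup_{s\in[0,T]}\|\gamma(\sigma+s)-\psi(0)\|_E\le\delta$. $\varGamma^1_{\sigma,\psi}(T,\delta,v)$ ($T>0$) is the set of $C^1$-prolongations $\gamma\colon[\sigma,\sigma+T]+I\to E$ of $(\sigma,\psi)$ with $\|\gamma(\sigma+\cdot)-\psi^{\wedge v}(\cdot)\|_{C^1[0,T]}\le\delta$ and $\gamma'(\sigma)=v$ (right derivative); $\varGamma^1_{\sigma,\psi}(0,\delta,v)=\{\psi(\cdot-\sigma)\}$. Put $$\varLambda_{\sigma,\psi}(T,\delta)=\bigcup_{\tau\in[0,T]}\{(\sigma+\tau,I_{\sigma+\tau}\gamma):\gamma\in\varGamma_{\sigma,\psi}(\tau,\delta)\},$$ $$\varLambda^1_{\sigma,\psi}(T,\delta,v)=\bigcup_{\tau\in[0,T]}\{(\sigma+\tau,I_{\sigma+\tau}\gamma):\gamma\in\varGamma^1_{\sigma,\psi}(\tau,\delta,v)\},$$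 and $\varLambda^1_{\sigma,\psi}(T,\delta;F):=\varLambda^1_{\sigma,\psi}(T,\delta,F(\sigma,\psi))$ for $(\sigma,\psi)\in\mathrm{dom}(F)$. Lipschitz conditions. For $L>0$ and $(t,\phi_1),(t,\phi_2)\in\mathrm{dom}(F)$ with $\mathrm{supp}(\phi_1-\phi_2)$ compact, $L$-(Lip) is the inequality $\|F(t,\phi_1)-F(t,\phi_2)\|_E\le L\|\phi_1-\phi_2\|_\infty$. $F$ is uniformly locally Lipschitzian about prolongations (resp. about $C^1$-prolongations) at $(\sigma_0,\psi_0)\in\mathrm{dom}(F)$ if there are a neighborhood $W_0$ of $(\sigma_0,\psi_0)$ in $\mathrm{dom}(F)$ and $T,\delta,L>0$ such that $L$-(Lip) holds for all $(\sigma,\psi)\in W_0$ and all $(t,\phi_1),(t,\phi_2)$ in $\varLambda_{\sigma,\psi}(T,\delta)\cap\mathrm{dom}(F)$ (resp. in $\varLambda^1_{\sigma,\psi}(T,\delta;F)\cap\mathrm{dom}(F)$). *)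

theory Defs
  imports "HOL-Analysis.Analysis" "HOL-Library.Set_Algebras"
begin

definition past_interval :: "real set \<Rightarrow> bool" where
  "past_interval I \<longleftrightarrow> is_interval I \<and> I \<subseteq> {..0} \<and> 0 \<in> I"

text \<open>Maps \<open>A \<rightarrow> E\<close> are represented by functions on the real line that vanish outside \<open>A\<close>.
  With this normalisation the linear operations of \<open>Map(A,E)\<close> are the pointwise ones
  and equality of maps is equality of functions.\<close>

definition Maps :: "real set \<Rightarrow> (real \<Rightarrow> 'e::real_normed_vector) set" where
  "Maps A = {f. \<forall>t. t \<notin> A \<longrightarrow> f t = 0}"

definition hist :: "real set \<Rightarrow> real \<Rightarrow> (real \<Rightarrow> 'e) \<Rightarrow> (real \<Rightarrow> 'e::real_normed_vector)" where
  "hist I t \<gamma> = (\<lambda>\<theta>. if \<theta> \<in> I then \<gamma> (t + \<theta>) else 0)"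

text \<open>The underlying linear space of a history space \<open>H\<close> is \<open>topspace H\<close>. No separation axiom
  is imposed on the topology.\<close>

definition history_space :: "real set \<Rightarrow> (real \<Rightarrow> 'e::real_normed_vector) topology \<Rightarrow> bool" where
  "history_space I H \<longleftrightarrow>
     topspace H \<subseteq> Maps I \<and>
     (\<lambda>\<theta>. 0) \<in> topspace H \<and>
     (\<forall>\<phi>\<in>topspace H. \<forall>\<psi>\<in>topspace H. (\<lambda>\<theta>. \<phi> \<theta> + \<psi> \<theta>) \<in> topspace H) \<and>
     (\<forall>c. \<forall>\<phi>\<in>topspace H. (\<lambda>\<theta>. c *\<^sub>R \<phi> \<theta>) \<in> topspace H) \<and>
     continuous_map (prod_topology H H) H (\<lambda>(\<phi>, \<psi>). \<lambda>\<theta>. \<phi> \<theta> + \<psi> \<theta>) \<and>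
     continuous_map (prod_topology euclideanreal H) H (\<lambda>(c, \<phi>). \<lambda>\<theta>. c *\<^sub>R \<phi> \<theta>)"

definition prolongation ::
  "real set \<Rightarrow> real set \<Rightarrow> real \<Rightarrow> (real \<Rightarrow> 'e) \<Rightarrow> (real \<Rightarrow> 'e::real_normed_vector) \<Rightarrow> bool" where
  "prolongation I J \<sigma> \<psi> \<gamma> \<longleftrightarrow>
     is_interval J \<and> \<sigma> \<in> J \<and> (\<forall>t\<in>J. \<sigma> \<le> t) \<and>
     \<gamma> \<in> Maps (J + I) \<and> hist I \<sigma> \<gamma> = \<psi> \<and> continuous_on J \<gamma>"

text \<open>Derivatives are taken within \<open>J\<close>, hence one-sided at end points belonging to \<open>J\<close>
  (\<open>\<gamma>\<close> may be irregular to the left of \<open>\<sigma>\<close>). The condition is vacuous for \<open>J = {\<sigma>}\<close>.\<close>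

definition C1_on :: "real set \<Rightarrow> (real \<Rightarrow> 'e::real_normed_vector) \<Rightarrow> bool" where
  "C1_on J f \<longleftrightarrow>
     (\<exists>f'. (\<forall>t\<in>J. (f has_vector_derivative f' t) (at t within J)) \<and> continuous_on J f')"

definition C1_prolongation ::
  "real set \<Rightarrow> real set \<Rightarrow> real \<Rightarrow> (real \<Rightarrow> 'e) \<Rightarrow> (real \<Rightarrow> 'e::real_normed_vector) \<Rightarrow> bool" where
  "C1_prolongation I J \<sigma> \<psi> \<gamma> \<longleftrightarrow> prolongation I J \<sigma> \<psi> \<gamma> \<and> C1_on J \<gamma>"

definition closed_under_prolongations ::
  "real set \<Rightarrow> (real \<Rightarrow> 'e::real_normed_vector) set \<Rightarrow> bool" where
  "closed_under_prolongations I H \<longleftrightarrow>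
     (\<forall>\<psi>\<in>H. \<forall>\<gamma>. prolongation I {0..} 0 \<psi> \<gamma> \<longrightarrow> (\<forall>t\<ge>0. hist I t \<gamma> \<in> H))"

definition ray :: "(real \<Rightarrow> 'e) \<Rightarrow> 'e \<Rightarrow> (real \<Rightarrow> 'e::real_normed_vector)" where
  "ray \<psi> v = (\<lambda>t. if t \<ge> 0 then \<psi> 0 + t *\<^sub>R v else \<psi> t)"

definition sup_norm :: "real set \<Rightarrow> (real \<Rightarrow> 'e::real_normed_vector) \<Rightarrow> ereal" where
  "sup_norm A f = (SUP t\<in>A. ereal (norm (f t)))"

definition C1_norm :: "real \<Rightarrow> (real \<Rightarrow> 'e::real_normed_vector) \<Rightarrow> ereal" where
  "C1_norm T g =
     sup_norm {0..T} g + sup_norm {0..T} (\<lambda>s. vector_derivative g (at s within {0..T}))"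

definition Gam ::
  "real set \<Rightarrow> real \<Rightarrow> (real \<Rightarrow> 'e) \<Rightarrow> real \<Rightarrow> ereal \<Rightarrow> (real \<Rightarrow> 'e::real_normed_vector) set" where
  "Gam I \<sigma> \<psi> T \<delta> =
     {\<gamma>. prolongation I {\<sigma>..\<sigma> + T} \<sigma> \<psi> \<gamma> \<and> sup_norm {0..T} (\<lambda>s. \<gamma> (\<sigma> + s) - \<psi> 0) \<le> \<delta>}"

definition Gam1 ::
  "real set \<Rightarrow> real \<Rightarrow> (real \<Rightarrow> 'e) \<Rightarrow> real \<Rightarrow> ereal \<Rightarrow> 'e \<Rightarrow> (real \<Rightarrow> 'e::real_normed_vector) set" where
  "Gam1 I \<sigma> \<psi> T \<delta> v =
     (if T = 0 then {\<lambda>t. \<psi> (t - \<sigma>)}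
      else {\<gamma>. C1_prolongation I {\<sigma>..\<sigma> + T} \<sigma> \<psi> \<gamma> \<and>
               C1_norm T (\<lambda>s. \<gamma> (\<sigma> + s) - ray \<psi> v s) \<le> \<delta> \<and>
               (\<gamma> has_vector_derivative v) (at_right \<sigma>)})"

definition Lam ::
  "real set \<Rightarrow> real \<Rightarrow> (real \<Rightarrow> 'e) \<Rightarrow> real \<Rightarrow> ereal \<Rightarrow> (real \<times> (real \<Rightarrow> 'e::real_normed_vector)) set" where
  "Lam I \<sigma> \<psi> T \<delta> =
     (\<Union>\<tau>\<in>{0..T}. {(\<sigma> + \<tau>, hist I (\<sigma> + \<tau>) \<gamma>) | \<gamma>. \<gamma> \<in> Gam I \<sigma> \<psi> \<tau> \<delta>})"

definition Lam1 ::
  "real set \<Rightarrow> real \<Rightarrow> (real \<Rightarrow> 'e) \<Rightarrow> real \<Rightarrow> ereal \<Rightarrow> 'e \<Rightarrow> (real \<times> (real \<Rightarrow> 'e::real_normed_vector)) set" where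
  "Lam1 I \<sigma> \<psi> T \<delta> v =
     (\<Union>\<tau>\<in>{0..T}. {(\<sigma> + \<tau>, hist I (\<sigma> + \<tau>) \<gamma>) | \<gamma>. \<gamma> \<in> Gam1 I \<sigma> \<psi> \<tau> \<delta> v})"

text \<open>The support is the closure relative to the domain \<open>I\<close>.\<close>

definition supp :: "real set \<Rightarrow> (real \<Rightarrow> 'e::real_normed_vector) \<Rightarrow> real set" where
  "supp I \<phi> = I \<inter> closure {\<theta>\<in>I. \<phi> \<theta> \<noteq> 0}"

text \<open>A partial map \<open>F\<close> with domain \<open>D\<close> is given by a total function whose values outside \<open>D\<close>
  are never used. \<open>Lip_on I F L S\<close> says that the inequality \<open>L\<close>-(Lip) holds for all
  \<open>(t,\<phi>\<^sub>1)\<close>, \<open>(t,\<phi>\<^sub>2)\<close> in \<open>S\<close> for which it is defined, i.e. with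
  \<open>\<phi>\<^sub>1 - \<phi>\<^sub>2\<close> of compact support.\<close>

definition Lip_on ::
  "real set \<Rightarrow> (real \<times> (real \<Rightarrow> 'e) \<Rightarrow> 'e) \<Rightarrow> real \<Rightarrow> (real \<times> (real \<Rightarrow> 'e::real_normed_vector)) set \<Rightarrow> bool" where
  "Lip_on I F L S \<longleftrightarrow>
     (\<forall>t \<phi>\<^sub>1 \<phi>\<^sub>2. (t, \<phi>\<^sub>1) \<in> S \<longrightarrow> (t, \<phi>\<^sub>2) \<in> S \<longrightarrow> compact (supp I (\<lambda>\<theta>. \<phi>\<^sub>1 \<theta> - \<phi>\<^sub>2 \<theta>)) \<longrightarrow>
        ereal (norm (F (t, \<phi>\<^sub>1) - F (t, \<phi>\<^sub>2))) \<le> ereal L * sup_norm I (\<lambda>\<theta>. \<phi>\<^sub>1 \<theta> - \<phi>\<^sub>2 \<theta>))"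

definition nhd_in :: "'a topology \<Rightarrow> 'a \<Rightarrow> 'a set \<Rightarrow> bool" where
  "nhd_in X x W \<longleftrightarrow> W \<subseteq> topspace X \<and> (\<exists>U. openin X U \<and> x \<in> U \<and> U \<subseteq> W)"

definition dom_topology ::
  "(real \<Rightarrow> 'e) topology \<Rightarrow> (real \<times> (real \<Rightarrow> 'e)) set \<Rightarrow> (real \<times> (real \<Rightarrow> 'e)) topology" where
  "dom_topology H D = subtopology (prod_topology euclideanreal H) D"

definition unif_loc_Lip_prolongations ::
  "real set \<Rightarrow> (real \<Rightarrow> 'e) topology \<Rightarrow> (real \<times> (real \<Rightarrow> 'e)) set \<Rightarrow>
   (real \<times> (real \<Rightarrow> 'e) \<Rightarrow> 'e) \<Rightarrow> real \<times> (real \<Rightarrow> 'e::real_normed_vector) \<Rightarrow> bool" where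
  "unif_loc_Lip_prolongations I H D F p \<longleftrightarrow>
     (\<exists>W T \<delta> L. nhd_in (dom_topology H D) p W \<and> T > 0 \<and> \<delta> > 0 \<and> L > 0 \<and>
        (\<forall>(\<sigma>, \<psi>)\<in>W. Lip_on I F L (Lam I \<sigma> \<psi> T (ereal \<delta>) \<inter> D)))"

definition unif_loc_Lip_C1_prolongations ::
  "real set \<Rightarrow> (real \<Rightarrow> 'e) topology \<Rightarrow> (real \<times> (real \<Rightarrow> 'e)) set \<Rightarrow>
   (real \<times> (real \<Rightarrow> 'e) \<Rightarrow> 'e) \<Rightarrow> real \<times> (real \<Rightarrow> 'e::real_normed_vector) \<Rightarrow> bool" where
  "unif_loc_Lip_C1_prolongations I H D F p \<longleftrightarrow>
     (\<exists>W T \<delta> L. nhd_in (dom_topology H D) p W \<and> T > 0 \<and> \<delta> > 0 \<and> L > 0 \<and>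
        (\<forall>(\<sigma>, \<psi>)\<in>W. Lip_on I F L (Lam1 I \<sigma> \<psi> T (ereal \<delta>) (F (\<sigma>, \<psi>)) \<inter> D)))"

definition locally_bounded_at ::
  "(real \<Rightarrow> 'e) topology \<Rightarrow> (real \<times> (real \<Rightarrow> 'e)) set \<Rightarrow>
   (real \<times> (real \<Rightarrow> 'e) \<Rightarrow> 'e) \<Rightarrow> real \<times> (real \<Rightarrow> 'e::real_normed_vector) \<Rightarrow> bool" where
  "locally_bounded_at H D F p \<longleftrightarrow> (\<exists>W. nhd_in (dom_topology H D) p W \<and> bounded (F ` W))"

end

theory Submission
  imports Defs
begin

text \<open>A \<open>C\<^sup>1\<close>-prolongation \<open>\<gamma>\<close> that is \<open>\<epsilon>\<close>-close in \<open>C\<^sup>1\<close> to the ray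
  \<open>s \<mapsto> \<psi>(0) + s v\<close> on \<open>[0,\<tau>]\<close> is in particular \<open>\<epsilon>\<close>-close to it in the sup norm, and the ray
  itself moves away from \<open>\<psi>(0)\<close> by at most \<open>\<tau> \<parallel>v\<parallel>\<close>. Hence \<open>\<gamma>\<close> stays within
  \<open>\<epsilon> + \<tau> \<parallel>v\<parallel>\<close> of \<open>\<psi>(0)\<close>, which gives
  \<open>\<Lambda>\<^sup>1(T,\<epsilon>,v) \<subseteq> \<Lambda>(T,\<delta>)\<close> as soon as \<open>\<epsilon> + T \<parallel>v\<parallel> \<le> \<delta>\<close> (lemma \<open>Lam1_subset_Lam\<close>).

  In the Lipschitz condition about \<open>C\<^sup>1\<close>-prolongations the slope is \<open>v = F(\<sigma>,\<psi>)\<close>, which depends on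
  the base point. Local boundedness of \<open>F\<close> supplies one bound \<open>\<parallel>v\<parallel> \<le> B\<close> for all base points in
  a neighborhood, so a single shorter time \<open>T\<close> and the tolerance \<open>\<epsilon> = \<delta>/2\<close> serve all of them, and
  the Lipschitz estimate on the larger sets \<open>\<Lambda>(T,\<delta>)\<close> is inherited with the same constant.\<close>

lemma nhd_in_Int:
  assumes "nhd_in X x V" and "nhd_in X x W"
  shows "nhd_in X x (V \<inter> W)"
proof -
  obtain A B where "openin X A" "x \<in> A" "A \<subseteq> V" "openin X B" "x \<in> B" "B \<subseteq> W"
    using assms unfolding nhd_in_def by auto
  then have "openin X (A \<inter> B) \<and> x \<in> A \<inter> B \<and> A \<inter> B \<subseteq> V \<inter> W"
    by auto
  then show ?thesis
    using assms unfolding nhd_in_def by blast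
qed

lemma Lip_on_mono:
  assumes "Lip_on I F L S" and "R \<subseteq> S"
  shows "Lip_on I F L R"
  using assms unfolding Lip_on_def by blast

lemma sup_norm_nonneg:
  assumes "A \<noteq> {}"
  shows "0 \<le> sup_norm A f"
proof -
  obtain a where "a \<in> A"
    using assms by blast
  then show ?thesis
    unfolding sup_norm_def by (intro SUP_upper2[of a]) auto
qed

lemma sup_norm_le_C1_norm:
  assumes "0 \<le> T"
  shows "sup_norm {0..T} g \<le> C1_norm T g"
  unfolding C1_norm_def using assms
  by (intro add_increasing2 sup_norm_nonneg) auto

lemma norm_le_of_sup_norm_le:
  assumes "sup_norm A f \<le> ereal c" and "t \<in> A"
  shows "norm (f t) \<le> c"
proof -
  have "ereal (norm (f t)) \<le> sup_norm A f"
    unfolding sup_norm_def by (rule SUP_upper[OF assms(2)])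
  then show ?thesis
    using assms(1) ereal_less_eq(3) order_trans by blast
qed

text \<open>The degenerate case \<open>J = {\<sigma>}\<close>, in which \<open>Gam1\<close> consists of the translate alone; that \<open>\<psi>\<close>
  vanishes outside \<open>I\<close> is what puts the translate into the normalised representation.\<close>

lemma translate_in_Gam_zero:
  assumes \<psi>: "\<psi> \<in> Maps I" and "0 \<le> \<delta>"
  shows "(\<lambda>t. \<psi> (t - \<sigma>)) \<in> Gam I \<sigma> \<psi> 0 (ereal \<delta>)"
proof -
  have "\<psi> (t - \<sigma>) = 0" if "t \<notin> {\<sigma>} + I" for t
  proof -
    have "t - \<sigma> \<notin> I"
      using that set_plus_intro[of \<sigma> "{\<sigma>}" "t - \<sigma>" I] by auto
    then show ?thesis
      using \<psi> unfolding Maps_def by blast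
  qed
  moreover have "hist I \<sigma> (\<lambda>t. \<psi> (t - \<sigma>)) = \<psi>"
    using \<psi> unfolding hist_def Maps_def by auto
  ultimately have "prolongation I {\<sigma>..\<sigma> + 0} \<sigma> \<psi> (\<lambda>t. \<psi> (t - \<sigma>))"
    unfolding prolongation_def using is_interval_cc[of \<sigma> \<sigma>] by (simp add: Maps_def)
  then show ?thesis
    unfolding Gam_def sup_norm_def using assms(2) by simp
qed

lemma Gam1_subset_Gam:
  assumes "\<psi> \<in> Maps I" and "0 \<le> \<tau>" and "0 \<le> \<delta>"
    and small: "\<epsilon> + \<tau> * norm v \<le> \<delta>"
  shows "Gam1 I \<sigma> \<psi> \<tau> (ereal \<epsilon>) v \<subseteq> Gam I \<sigma> \<psi> \<tau> (ereal \<delta>)"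
proof (cases "\<tau> = 0")
  case True
  then show ?thesis
    using translate_in_Gam_zero assms by (auto simp: Gam1_def)
next
  case False
  show ?thesis
  proof
    fix \<gamma> assume "\<gamma> \<in> Gam1 I \<sigma> \<psi> \<tau> (ereal \<epsilon>) v"
    then have pro: "prolongation I {\<sigma>..\<sigma> + \<tau>} \<sigma> \<psi> \<gamma>"
      and C1: "C1_norm \<tau> (\<lambda>s. \<gamma> (\<sigma> + s) - ray \<psi> v s) \<le> ereal \<epsilon>"
      using False by (auto simp: Gam1_def C1_prolongation_def)
    have near_ray: "sup_norm {0..\<tau>} (\<lambda>s. \<gamma> (\<sigma> + s) - ray \<psi> v s) \<le> ereal \<epsilon>"
      using sup_norm_le_C1_norm[OF assms(2)] C1 by (rule order_trans)
    have "norm (\<gamma> (\<sigma> + s) - \<psi> 0) \<le> \<delta>" if s: "s \<in> {0..\<tau>}" for s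
    proof -
      have "norm (\<gamma> (\<sigma> + s) - \<psi> 0) \<le> norm (\<gamma> (\<sigma> + s) - ray \<psi> v s) + norm (s *\<^sub>R v)"
        using norm_triangle_ineq[of "\<gamma> (\<sigma> + s) - ray \<psi> v s" "s *\<^sub>R v"] s
        by (simp add: ray_def algebra_simps)
      also have "\<dots> \<le> \<epsilon> + \<tau> * norm v"
        using norm_le_of_sup_norm_le[OF near_ray s] s
        by (intro add_mono) (auto intro: mult_right_mono)
      finally show ?thesis
        using small by simp
    qed
    then have "sup_norm {0..\<tau>} (\<lambda>s. \<gamma> (\<sigma> + s) - \<psi> 0) \<le> ereal \<delta>"
      unfolding sup_norm_def by (intro SUP_least) simp
    with pro show "\<gamma> \<in> Gam I \<sigma> \<psi> \<tau> (ereal \<delta>)"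
      by (simp add: Gam_def)
  qed
qed

lemma Lam1_subset_Lam:
  assumes "\<psi> \<in> Maps I" and "0 \<le> \<delta>"
    and "\<epsilon> + T * norm v \<le> \<delta>" and "T \<le> T'"
  shows "Lam1 I \<sigma> \<psi> T (ereal \<epsilon>) v \<subseteq> Lam I \<sigma> \<psi> T' (ereal \<delta>)"
proof -
  have "Gam1 I \<sigma> \<psi> \<tau> (ereal \<epsilon>) v \<subseteq> Gam I \<sigma> \<psi> \<tau> (ereal \<delta>)" if "\<tau> \<in> {0..T}" for \<tau>
  proof (rule Gam1_subset_Gam[OF assms(1) _ assms(2)])
    have "\<tau> * norm v \<le> T * norm v"
      using that by (intro mult_right_mono) auto
    then show "\<epsilon> + \<tau> * norm v \<le> \<delta>"
      using assms(3) by simp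
  qed (use that in simp)
  moreover have "{0..T} \<subseteq> {0..T'}"
    using assms(4) by simp
  ultimately show ?thesis
    unfolding Lam1_def Lam_def by (intro UN_mono) blast+
qed

theorem proposition4p3:
  fixes I :: "real set"
    and H :: "(real \<Rightarrow> 'e::banach) topology"
    and D :: "(real \<times> (real \<Rightarrow> 'e)) set"
    and F :: "real \<times> (real \<Rightarrow> 'e) \<Rightarrow> 'e"
    and \<sigma>\<^sub>0 :: real and \<psi>\<^sub>0 :: "real \<Rightarrow> 'e"
  assumes "past_interval I"
    and "history_space I H"
    and "D \<subseteq> UNIV \<times> topspace H"
    and "(\<sigma>\<^sub>0, \<psi>\<^sub>0) \<in> D"
    and "closed_under_prolongations I (topspace H)"
    and "unif_loc_Lip_prolongations I H D F (\<sigma>\<^sub>0, \<psi>\<^sub>0)"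
    and "locally_bounded_at H D F (\<sigma>\<^sub>0, \<psi>\<^sub>0)"
  shows "unif_loc_Lip_C1_prolongations I H D F (\<sigma>\<^sub>0, \<psi>\<^sub>0)"
proof -
  obtain W\<^sub>1 T \<delta> L where W\<^sub>1: "nhd_in (dom_topology H D) (\<sigma>\<^sub>0, \<psi>\<^sub>0) W\<^sub>1"
    and pos: "T > 0" "\<delta> > 0" "L > 0"
    and Lip: "\<And>\<sigma> \<psi>. (\<sigma>, \<psi>) \<in> W\<^sub>1 \<Longrightarrow> Lip_on I F L (Lam I \<sigma> \<psi> T (ereal \<delta>) \<inter> D)"
    using assms(6) unfolding unif_loc_Lip_prolongations_def by fast
  obtain W\<^sub>2 where W\<^sub>2: "nhd_in (dom_topology H D) (\<sigma>\<^sub>0, \<psi>\<^sub>0) W\<^sub>2" and "bounded (F ` W\<^sub>2)"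
    using assms(7) unfolding locally_bounded_at_def by blast
  then obtain B where "B > 0" and B: "\<And>p. p \<in> W\<^sub>2 \<Longrightarrow> norm (F p) \<le> B"
    unfolding bounded_pos by blast
  \<comment> \<open>Half of \<open>\<delta>\<close> is spent on the distance to the ray, the other half on the ray's own motion
    at speed at most \<open>B\<close>.\<close>
  define T' where "T' = min T (\<delta> / (2 * B))"
  have "T' > 0" "T' \<le> T"
    using pos \<open>B > 0\<close> by (auto simp: T'_def)
  have "T' * B \<le> \<delta> / (2 * B) * B"
    using \<open>B > 0\<close> by (intro mult_right_mono) (auto simp: T'_def)
  then have T'B: "T' * B \<le> \<delta> / 2"
    using \<open>B > 0\<close> by simp
  have "Lip_on I F L (Lam1 I \<sigma> \<psi> T' (ereal (\<delta> / 2)) (F (\<sigma>, \<psi>)) \<inter> D)"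
    if p: "(\<sigma>, \<psi>) \<in> W\<^sub>1 \<inter> W\<^sub>2" for \<sigma> \<psi>
  proof -
    have "(\<sigma>, \<psi>) \<in> D"
      using p W\<^sub>1 by (auto simp: nhd_in_def dom_topology_def)
    then have "\<psi> \<in> Maps I"
      using assms(2,3) by (auto simp: history_space_def)
    moreover have "T' * norm (F (\<sigma>, \<psi>)) \<le> T' * B"
      using B p \<open>T' > 0\<close> by (intro mult_left_mono) auto
    ultimately have "Lam1 I \<sigma> \<psi> T' (ereal (\<delta> / 2)) (F (\<sigma>, \<psi>)) \<subseteq> Lam I \<sigma> \<psi> T (ereal \<delta>)"
      using T'B pos \<open>T' \<le> T\<close> by (intro Lam1_subset_Lam) auto
    with Lip[of \<sigma> \<psi>] p show ?thesis
      by (blast intro: Lip_on_mono)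
  qed
  moreover have "\<delta> / 2 > 0"
    using pos by simp
  ultimately show ?thesis
    unfolding unif_loc_Lip_C1_prolongations_def
    using nhd_in_Int[OF W\<^sub>1 W\<^sub>2] \<open>T' > 0\<close> \<open>L > 0\<close>
    by (intro exI[of _ "W\<^sub>1 \<inter> W\<^sub>2"] exI[of _ T'] exI[of _ "\<delta> / 2"] exI[of _ L]) auto
qed

end
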